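(* Let $K$ be an infinite field, $n\ge 2$, $S=K[x_1,\ldots,x_n]$, and let $M$ be a finitely generated $\mathbb Z^n$-graded $S$-module. If $M_{\geq e}$ is strongly stable for some integer $e$, then $M$ is of Borel type.
   Context: $S$ carries its standard $\mathbb Z^n$-grading. $[n]=\{1,\ldots,n\}$. For a monomial ideal $I\subset S$ and a $\mathbb Z^n$-graded $S$-module $M$, $\Gamma_I(M)=\bigcup_{k\ge 1}(0:_M I^k)$. The torsion submodule is $t(M)=\{z\in M:\ \text{there exists } 0\ne u\in S \text{ with } uz=0\}$. A finitely generated $\mathbb Z^n$-graded $S$-module $M$ is of Borel type if $t(M)=M$ and $\Gamma_{(x_i)}(M)=\Gamma_{(x_1,\ldots,x_i)}(M)$ for all $i\in[n]$. A finitely generated $\mathbb Z^n$-graded $S$-module $N$ is strongly stable if $t(N)=N$ and $(0:_N x_i)\subset(0:_N x_j)$ for all $1\le j<i\le n$. A $\mathbb Z^n$-graded module is regarded as $\mathbb Z$-graded by $M=\bigoplus_{j\in\mathbb Z}\big(\bigoplus_{a\in\mathbb Z^n,\ |a|=j}M_a\big)$, $|a|=a_1+\cdots+a_n$. For an integer $e$, $M_{\ge e}$ is the submodule of $M$ generated by the set of homogeneous elements $z\in M$ with $\deg(z)\ge e$ (degree in the $\mathbb Z$-grading). *)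

theory Defs
  imports Complex_Main "HOL-Library.Poly_Mapping" "HOL-Library.Numeral_Type"
begin

text \<open>
  The polynomial ring in \<open>n\<close> ordered variables over \<open>'k\<close>: finitely supported functions from
  exponent vectors to coefficients, with convolution as multiplication. The index set
  \<open>{1,\<dots>,n}\<close> is a finite linearly ordered type \<open>'n\<close> with \<open>n = CARD('n)\<close>; only
  the order of the indices matters below.
\<close>

type_synonym ('n, 'k) mpoly = "('n \<Rightarrow>\<^sub>0 nat) \<Rightarrow>\<^sub>0 'k"

type_synonym 'n multidegree = "'n \<Rightarrow> int"

definition X :: "'n \<Rightarrow> ('n, 'k::zero_neq_one) mpoly"
  where "X i = Poly_Mapping.single (Poly_Mapping.single i 1) 1"

text \<open>The standard grading: \<open>mpoly_component b\<close> is \<open>K x\<^sup>b\<close> if \<open>b\<close> is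
  nonnegative, and \<open>0\<close> otherwise.\<close>

definition mpoly_component :: "'n multidegree \<Rightarrow> ('n, 'k::zero) mpoly set"
  where "mpoly_component b =
    {p. \<forall>m \<in> Poly_Mapping.keys p. \<forall>i. int (Poly_Mapping.lookup m i) = b i}"

interpretation ideal: module "(*) :: 'a::comm_ring_1 \<Rightarrow> 'a \<Rightarrow> 'a"
  by unfold_locales (simp_all add: algebra_simps)

definition ideal_power :: "'a::comm_ring_1 set \<Rightarrow> nat \<Rightarrow> 'a set"
  where "ideal_power I k = ideal.span {\<Prod>j<k. f j | f. \<forall>j<k. f j \<in> I}"

text \<open>
  Finitely generated multigraded modules. The module is the whole type \<open>'m\<close>, and
  \<open>component a\<close> is its component of multidegree \<open>a\<close>; the last assumption but one says
  that the module is the direct sum of its components.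
\<close>

locale fg_multigraded_module = module scale
  for scale :: "('n::{finite,linorder}, 'k::field) mpoly \<Rightarrow> 'm::ab_group_add \<Rightarrow> 'm"
    (infixr \<open>*s\<close> 75) +
  fixes component :: "'n multidegree \<Rightarrow> 'm set"
  assumes component_zero: "0 \<in> component a"
    and component_diff: "x \<in> component a \<Longrightarrow> y \<in> component a \<Longrightarrow> x - y \<in> component a"
    and component_scale:
      "p \<in> mpoly_component b \<Longrightarrow> z \<in> component a \<Longrightarrow> p *s z \<in> component (\<lambda>i. b i + a i)"
    and component_direct_sum:
      "\<exists>!d. (\<forall>a. d a \<in> component a) \<and> finite {a. d a \<noteq> 0} \<and> z = (\<Sum>a | d a \<noteq> 0. d a)"
    and finitely_generated: "\<exists>B. finite B \<and> span B = UNIV"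
begin

text \<open>The notions below are stated for a submodule \<open>N\<close> of the module; the module itself
  is \<open>N = UNIV\<close>. That \<open>N\<close> is graded and finitely generated is not part of
  \<open>borel_type\<close> and \<open>strongly_stable\<close>: it is an assumption of the locale for
  \<open>UNIV\<close>, and automatic for \<open>truncation e\<close>.\<close>

definition torsion :: "'m set \<Rightarrow> 'm set"
  where "torsion N = {z \<in> N. \<exists>u. u \<noteq> 0 \<and> u *s z = 0}"

definition annihilated :: "'m set \<Rightarrow> ('n, 'k) mpoly set \<Rightarrow> 'm set"
  where "annihilated N A = {z \<in> N. \<forall>u\<in>A. u *s z = 0}"

definition Gamma :: "('n, 'k) mpoly set \<Rightarrow> 'm set \<Rightarrow> 'm set"
  where "Gamma I N = (\<Union>k\<in>{1..}. annihilated N (ideal_power I k))"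

definition borel_type :: "'m set \<Rightarrow> bool"
  where "borel_type N \<longleftrightarrow> torsion N = N \<and>
    (\<forall>i. Gamma (ideal.span {X i}) N = Gamma (ideal.span (X ` {..i})) N)"

definition strongly_stable :: "'m set \<Rightarrow> bool"
  where "strongly_stable N \<longleftrightarrow> torsion N = N \<and>
    (\<forall>i j. j < i \<longrightarrow> annihilated N {X i} \<subseteq> annihilated N {X j})"

text \<open>The \<open>\<int>\<close>-grading by total degree: the sum of the components \<open>component a\<close>
  with \<open>a\<^sub>1 + \<dots> + a\<^sub>n = j\<close>.\<close>

definition total_component :: "int \<Rightarrow> 'm set"
  where "total_component j =
    {\<Sum>a\<in>A. d a | A d. finite A \<and> (\<forall>a\<in>A. (\<Sum>i\<in>UNIV. a i) = j \<and> d a \<in> component a)}"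

definition truncation :: "int \<Rightarrow> 'm set"
  where "truncation e = span (\<Union>j\<in>{e..}. total_component j)"

end

end

theory Submission
  imports Defs
begin

text \<open>
  High powers of every variable move a given element into the truncation. Torsion therefore lifts
  from the truncation to the module. If \<open>x\<^sub>i\<^sup>k z = 0\<close> and \<open>j < i\<close>, then
  \<open>w = x\<^sub>j\<^sup>l z\<close> lies in the truncation for large \<open>l\<close>, where strong stability
  trades the factors \<open>x\<^sub>i\<close> of \<open>x\<^sub>i\<^sup>k w = 0\<close> one at a time for factors
  \<open>x\<^sub>j\<close>, giving \<open>x\<^sub>j\<^bsup>k+l\<^esup> z = 0\<close>. An element killed by powers of
  \<open>x\<^sub>1,\<dots>,x\<^sub>i\<close> is killed by a power of the ideal they generate.
\<close>

lemma X_nonzero: "(X i :: ('n, 'k::zero_neq_one) mpoly) \<noteq> 0"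
  by (metis X_def lookup_single_eq lookup_zero zero_neq_one)

lemma X_in_mpoly_component:
  "(X i :: ('n, 'k::zero_neq_one) mpoly) \<in> mpoly_component (\<lambda>j. if j = i then 1 else 0)"
  by (simp add: X_def mpoly_component_def lookup_single when_def)

lemma ideal_power_mono: "I \<subseteq> J \<Longrightarrow> ideal_power I k \<subseteq> ideal_power J k"
  unfolding ideal_power_def by (intro ideal.span_mono) blast

lemma power_in_ideal_power: "x \<in> I \<Longrightarrow> x ^ k \<in> ideal_power I k"
  unfolding ideal_power_def
  by (rule ideal.span_base) (auto intro!: exI[of _ "\<lambda>_. x"])

context module
begin

text \<open>Together with \<open>ideal.span_minimal\<close>, this reduces the vanishing of a whole
  ideal, or of a power of it, on \<open>z\<close> to that of generators.\<close>

lemma subspace_annihilator: "ideal.subspace {u. u *s z = 0}"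
  by (rule ideal.subspaceI) (auto simp: scale_left_distrib simp flip: scale_scale)

text \<open>A pigeonhole argument that never expands the product: factors are replaced by generators
  one at a time. Each generator is absorbed into \<open>w\<close>, lowering both the sum of the
  exponents and the number of factors by one, so \<open>e\<close> and \<open>w\<close> vary in the
  induction.\<close>

lemma prod_span_scale_eq_0:
  assumes "finite A"
    and "\<And>x. x \<in> A \<Longrightarrow> x ^ e x *s w = 0"
    and "(\<Sum>x\<in>A. e x) < k"
    and "\<And>j. j < k \<Longrightarrow> f j \<in> ideal.span A"
  shows "(\<Prod>j<k. f j) *s w = 0"
  using assms(2-)
proof (induction k arbitrary: e w)
  case 0
  then show ?case by simp
next
  case (Suc k)
  let ?P = "\<Prod>j<k. f j"
  \<comment> \<open>The condition on the last factor \<open>f k\<close> is linear, so it suffices to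
    check it on a generator \<open>x\<close>.\<close>
  have "ideal.span A \<subseteq> {u. u *s (?P *s w) = 0}"
  proof (rule ideal.span_minimal)
    show "A \<subseteq> {u. u *s (?P *s w) = 0}"
    proof
      fix x assume x: "x \<in> A"
      have "?P *s (x *s w) = 0"
      proof (cases "e x")
        case 0
        \<comment> \<open>Here \<open>w = x ^ 0 *s w\<close> is already zero.\<close>
        then show ?thesis using Suc.prems(1)[OF x] by simp
      next
        case (Suc m)
        show ?thesis
        \<comment> \<open>\<open>x ^ m\<close> kills \<open>x *s w\<close>, one power less than the
          bound for \<open>w\<close>; the other bounds carry over.\<close>
        proof (rule Suc.IH[where e = "e(x := m)"])
          fix y assume y: "y \<in> A"
          show "y ^ (e(x := m)) y *s x *s w = 0"
          proof (cases "y = x")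
            case True
            then show ?thesis using Suc.prems(1)[OF x] Suc by (simp add: mult.commute)
          next
            case False
            then show ?thesis
              using Suc.prems(1)[OF y] by (metis fun_upd_other scale_left_commute scale_zero_right)
          qed
        next
          show "(\<Sum>y\<in>A. (e(x := m)) y) < k"
            using Suc.prems(2) Suc x assms(1)
            by (simp add: sum.remove[where x = x])
        qed (use Suc.prems(3) in simp)
      qed
      then show "x \<in> {u. u *s (?P *s w) = 0}"
        by (simp add: mult.commute)
    qed
  qed (rule subspace_annihilator)
  then have "f k *s (?P *s w) = 0"
    using Suc.prems(3)[of k] by blast
  then show ?case by (simp add: mult.commute)
qed

lemma ideal_power_span_annihilates:
  assumes "finite A" and "\<And>x. x \<in> A \<Longrightarrow> \<exists>m. x ^ m *s z = 0"
  shows "\<exists>k\<ge>1. \<forall>u \<in> ideal_power (ideal.span A) k. u *s z = 0"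
proof -
  obtain e where e: "\<And>x. x \<in> A \<Longrightarrow> x ^ e x *s z = 0"
    using assms(2) by metis
  \<comment> \<open>The successor provides the strict inequality for the pigeonhole argument and
    also \<open>?k \<ge> 1\<close>.\<close>
  let ?k = "Suc (\<Sum>x\<in>A. e x)"
  have "ideal_power (ideal.span A) ?k \<subseteq> {u. u *s z = 0}"
    unfolding ideal_power_def
  proof (rule ideal.span_minimal)
    show "{\<Prod>j<?k. f j |f. \<forall>j<?k. f j \<in> ideal.span A} \<subseteq> {u. u *s z = 0}"
      using prod_span_scale_eq_0[OF assms(1) e, where k = ?k] by blast
  qed (rule subspace_annihilator)
  then show ?thesis by (intro exI[of _ ?k]) auto
qed

end

context fg_multigraded_module
begin

lemma X_power_scale_component:
  "z \<in> component a \<Longrightarrow> X i ^ l *s z \<in> component (\<lambda>j. (if j = i then int l else 0) + a j)"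
proof (induction l)
  case (Suc l)
  have "X i *s X i ^ l *s z
      \<in> component (\<lambda>j. (if j = i then 1 else 0) + ((if j = i then int l else 0) + a j))"
    using component_scale[OF X_in_mpoly_component Suc.IH[OF Suc.prems]] .
  moreover have "(\<lambda>j. (if j = i then 1 else 0) + ((if j = i then int l else 0) + a j))
      = (\<lambda>j. (if j = i then int (Suc l) else 0) + a j)"
    by auto
  ultimately show ?case by simp
qed (simp cong: if_cong)

lemma component_in_truncation:
  assumes "z \<in> component a" and "e \<le> (\<Sum>i\<in>UNIV. a i)"
  shows "z \<in> truncation e"
proof -
  have "z \<in> total_component (\<Sum>i\<in>UNIV. a i)"
    unfolding total_component_def using assms(1)
    by (auto intro!: exI[of _ "{a}"] exI[of _ "\<lambda>_. z"])
  then show ?thesis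
    unfolding truncation_def using assms(2) by (intro span_base) auto
qed

text \<open>Multiplication by \<open>X i ^ l\<close> raises total degrees by \<open>l\<close>, and
  \<open>z\<close> has only finitely many nonzero components, so one bound on \<open>l\<close>
  serves them all. Stated with \<open>eventually\<close>, the bounds combine without an explicit
  maximum.\<close>

lemma eventually_X_power_scale_in_truncation:
  "\<forall>\<^sub>F l in sequentially. X i ^ l *s z \<in> truncation e"
proof -
  obtain d where d: "\<And>a. d a \<in> component a" "finite {a. d a \<noteq> 0}"
      and z: "z = (\<Sum>a | d a \<noteq> 0. d a)"
    using component_direct_sum[of z] by blast
  have "\<forall>\<^sub>F l in sequentially. X i ^ l *s d a \<in> truncation e" for a
    \<comment> \<open>The gap between the degree of the component and \<open>e\<close>;
      \<open>nat\<close> makes it 0 if the degree is already at least \<open>e\<close>.\<close>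
    using eventually_ge_at_top[of "nat (e - (\<Sum>j\<in>UNIV. a j))"]
  proof eventually_elim
    case (elim l)
    have "(\<Sum>j\<in>UNIV. (if j = i then int l else 0) + a j) = int l + (\<Sum>j\<in>UNIV. a j)"
      by (simp add: sum.distrib)
    then show ?case
      using elim by (intro component_in_truncation[OF X_power_scale_component[OF d(1)]]) simp
  qed
  then have "\<forall>\<^sub>F l in sequentially. \<forall>a\<in>{a. d a \<noteq> 0}. X i ^ l *s d a \<in> truncation e"
    using d(2) by (intro eventually_ball_finite) auto
  then show ?thesis
  proof eventually_elim
    case (elim l)
    then show ?case
      unfolding z truncation_def by (auto simp: scale_sum_right intro!: span_sum)
  qed
qed

lemma truncation_scale: "z \<in> truncation e \<Longrightarrow> p *s z \<in> truncation e"
  unfolding truncation_def by (rule span_scale)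

lemma torsion_UNIV_if_truncation:
  assumes "torsion (truncation e) = truncation e"
  shows "torsion UNIV = UNIV"
proof -
  have "\<exists>u. u \<noteq> 0 \<and> u *s z = 0" for z
  proof -
    fix i :: 'n
    obtain l where "X i ^ l *s z \<in> truncation e"
      using eventually_happens[OF eventually_X_power_scale_in_truncation] trivial_limit_sequentially
        by blast
    then obtain u where "u \<noteq> 0" "u *s X i ^ l *s z = 0"
      using assms unfolding torsion_def by blast
    \<comment> \<open>The product \<open>u * X i ^ l\<close> is nonzero because the polynomial ring
      is a domain.\<close>
    then show ?thesis
      by (intro exI[of _ "u * X i ^ l"]) (simp add: X_nonzero)
  qed
  then show ?thesis unfolding torsion_def by blast
qed

lemma X_power_annihilates_if_strongly_stable:
  assumes "strongly_stable (truncation e)" and "j < i"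
  shows "w \<in> truncation e \<Longrightarrow> X i ^ k *s w = 0 \<Longrightarrow> X j ^ k *s w = 0"
proof (induction k arbitrary: w)
  case (Suc k)
  have "X i ^ k *s w \<in> annihilated (truncation e) {X i}"
    using Suc.prems by (simp add: annihilated_def truncation_scale)
  then have "X j *s X i ^ k *s w = 0"
    using assms unfolding strongly_stable_def annihilated_def by blast
  then have "X i ^ k *s X j *s w = 0"
    by (simp add: mult.commute)
  \<comment> \<open>After commuting the factors, the induction hypothesis applies to
    \<open>X j *s w\<close> in place of \<open>w\<close>.\<close>
  then have "X j ^ k *s X j *s w = 0"
    using Suc.prems(1) by (intro Suc.IH truncation_scale)
  then show ?case by (simp add: mult.commute)
qed simp

theorem borel_type_if_strongly_stable_truncation:
  assumes "strongly_stable (truncation e)"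
  shows "borel_type UNIV"
proof -
  have "Gamma (ideal.span {X i}) UNIV \<subseteq> Gamma (ideal.span (X ` {..i})) UNIV" for i
  proof
    fix z assume "z \<in> Gamma (ideal.span {X i}) UNIV"
    then obtain k where "\<forall>u \<in> ideal_power (ideal.span {X i}) k. u *s z = 0"
      by (auto simp: Gamma_def annihilated_def)
    then have k: "X i ^ k *s z = 0"
      by (simp add: power_in_ideal_power ideal.span_base)
    have "\<exists>m. X j ^ m *s z = 0" if "j \<le> i" for j
    proof (cases "j = i")
      case True
      then show ?thesis using k by blast
    next
      case False
      \<comment> \<open>Since \<open>z\<close> may lie outside the truncation, stability is applied
        to a multiple by a power of \<open>X j\<close>; that power merely adds to the final
        exponent.\<close>
      obtain l where l: "X j ^ l *s z \<in> truncation e"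
        using eventually_happens[OF eventually_X_power_scale_in_truncation] trivial_limit_sequentially
        by blast
      have "X i ^ k *s X j ^ l *s z = 0"
        using k by (metis scale_left_commute scale_zero_right)
      then have "X j ^ k *s X j ^ l *s z = 0"
        using X_power_annihilates_if_strongly_stable[OF assms _ l] False that
        by (metis order_le_less)
      then show ?thesis by (intro exI[of _ "k + l"]) (simp add: power_add)
    qed
    then have "\<exists>k\<ge>1. \<forall>u \<in> ideal_power (ideal.span (X ` {..i})) k. u *s z = 0"
      by (intro ideal_power_span_annihilates) auto
    then show "z \<in> Gamma (ideal.span (X ` {..i})) UNIV"
      by (auto simp: Gamma_def annihilated_def)
  qed
  \<comment> \<open>A smaller ideal has smaller powers, and these annihilate more elements.\<close>
  moreover have "Gamma (ideal.span (X ` {..i})) UNIV \<subseteq> Gamma (ideal.span {X i}) UNIV" for i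
  proof -
    have "ideal.span {X i} \<subseteq> ideal.span (X ` {..i} :: ('n, 'k) mpoly set)"
      by (rule ideal.span_mono) auto
    from ideal_power_mono[OF this] show ?thesis
      unfolding Gamma_def annihilated_def by blast
  qed
  moreover have "torsion UNIV = UNIV"
    using assms torsion_UNIV_if_truncation unfolding strongly_stable_def by blast
  ultimately show ?thesis unfolding borel_type_def by blast
qed

end

theorem proposition2p7:
  fixes scale :: "('n::{finite,linorder}, 'k::field) mpoly \<Rightarrow> 'm::ab_group_add \<Rightarrow> 'm"
    and component :: "'n multidegree \<Rightarrow> 'm set"
  assumes "infinite (UNIV :: 'k set)"
    and "CARD('n) \<ge> 2"
    and "fg_multigraded_module scale component"
    and "\<exists>e. fg_multigraded_module.strongly_stable scale
               (fg_multigraded_module.truncation scale component e)"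
  shows "fg_multigraded_module.borel_type scale UNIV"
  using assms(3,4) fg_multigraded_module.borel_type_if_strongly_stable_truncation by blast

end
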